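(* Let $n\ge 4$. Whenever $\mathrm{Aut}(F_n)$ acts by semisimple isometries on a complete $\mathrm{CAT}(0)$ space $X$, each Nielsen transformation in $\mathrm{Aut}(F_n)$ fixes a point of $X$.
   Context: $F_n$ is the free group of rank $n$ with a fixed basis $\{a_1,\dots,a_n\}$. The Nielsen transformations are the automorphisms, for $i\neq j$, $\lambda_{ij}: a_i\mapsto a_ja_i,\ a_k\mapsto a_k\ (k\ne i)$ and $\rho_{ij}: a_i\mapsto a_ia_j,\ a_k\mapsto a_k\ (k\neq i)$. For an isometry $\gamma$ of a complete $\mathrm{CAT}(0)$ space $X$, put $\|\gamma\|=\inf\{d(x,\gamma.x)\mid x\in X\}$ and $\mathrm{Min}(\gamma)=\{x\in X\mid d(x,\gamma.x)=\|\gamma\|\}$. The isometry $\gamma$ is semisimple if $\mathrm{Min}(\gamma)\ne\emptyset$. An action is by semisimple isometries if every group element acts as a semisimple isometry. *)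

theory Defs
  imports "HOL-Analysis.Analysis" "HOL-Algebra.Group_Action"
begin

section \<open>The free group of rank n\<close>

text \<open>
  A letter \<open>(k, True)\<close> stands for the basis element \<open>a\<^sub>k\<close> and \<open>(k, False)\<close> for its inverse,
  with \<open>1 \<le> k \<le> n\<close>. The elements of the free group are the reduced words.
\<close>

type_synonym letter = "nat \<times> bool"

definition flip_letter :: "letter \<Rightarrow> letter"
  where "flip_letter x = (fst x, \<not> snd x)"

definition reduced_words :: "nat \<Rightarrow> letter list set"
  where "reduced_words n =
    {w. fst ` set w \<subseteq> {1..n} \<and> successively (\<lambda>x y. y \<noteq> flip_letter x) w}"

definition cancel_Cons :: "letter \<Rightarrow> letter list \<Rightarrow> letter list"
  where "cancel_Cons x w = (if w \<noteq> [] \<and> hd w = flip_letter x then tl w else x # w)"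

text \<open>On reduced words, \<open>foldr cancel_Cons u v\<close> is the free reduction of \<open>u @ v\<close>.\<close>

definition free_group :: "nat \<Rightarrow> letter list monoid"
  where "free_group n =
    \<lparr>carrier = reduced_words n, mult = foldr cancel_Cons, one = []\<rparr>"

definition basis_elt :: "nat \<Rightarrow> letter list"
  where "basis_elt k = [(k, True)]"

lemma flip_letter_simps [simp]:
  "flip_letter (flip_letter x) = x" "fst (flip_letter x) = fst x"
  "snd (flip_letter x) = (\<not> snd x)" "flip_letter x \<noteq> x" "x \<noteq> flip_letter x"
  by (auto simp: flip_letter_def prod_eq_iff)

lemma flip_letter_eq_iff: "flip_letter x = y \<longleftrightarrow> x = flip_letter y"
  by (auto simp: flip_letter_def prod_eq_iff)

lemma reduced_words_Nil [simp]: "[] \<in> reduced_words n"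
  by (simp add: reduced_words_def)

lemma reduced_words_Cons:
  "x # w \<in> reduced_words n \<longleftrightarrow>
     fst x \<in> {1..n} \<and> w \<in> reduced_words n \<and> (w = [] \<or> hd w \<noteq> flip_letter x)"
  by (auto simp: reduced_words_def successively_Cons)

lemma cancel_Cons_closed:
  assumes "fst x \<in> {1..n}" "w \<in> reduced_words n"
  shows "cancel_Cons x w \<in> reduced_words n"
  using assms by (cases w) (auto simp: cancel_Cons_def reduced_words_Cons)

lemma cancel_Cons_flip:
  assumes "w \<in> reduced_words n"
  shows "cancel_Cons x (cancel_Cons (flip_letter x) w) = w"
  using assms by (cases w; cases "tl w") (auto simp: cancel_Cons_def reduced_words_Cons)

lemma foldr_cancel_Cons_closed:
  assumes "fst ` set u \<subseteq> {1..n}" "w \<in> reduced_words n"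
  shows "foldr cancel_Cons u w \<in> reduced_words n"
  using assms by (induction u) (auto intro!: cancel_Cons_closed)

lemma foldr_cancel_Cons_cancel:
  assumes "v \<in> reduced_words n" "w \<in> reduced_words n"
  shows "foldr cancel_Cons (cancel_Cons x v) w = cancel_Cons x (foldr cancel_Cons v w)"
proof (cases "v \<noteq> [] \<and> hd v = flip_letter x")
  case True
  then obtain v' where v: "v = flip_letter x # v'"
    by (cases v) auto
  have "fst ` set v' \<subseteq> {1..n}"
    using assms(1) by (auto simp: v reduced_words_def)
  then have "foldr cancel_Cons v' w \<in> reduced_words n"
    using assms(2) by (rule foldr_cancel_Cons_closed)
  then show ?thesis
    using cancel_Cons_flip by (simp add: v cancel_Cons_def[of x "flip_letter x # v'"])
qed (auto simp: cancel_Cons_def[of x v])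

lemma foldr_cancel_Cons_assoc:
  assumes "fst ` set u \<subseteq> {1..n}" "v \<in> reduced_words n" "w \<in> reduced_words n"
  shows "foldr cancel_Cons (foldr cancel_Cons u v) w
    = foldr cancel_Cons u (foldr cancel_Cons v w)"
  using assms(1)
proof (induction u)
  case (Cons x u)
  have "foldr cancel_Cons u v \<in> reduced_words n"
    using Cons.prems assms(2) by (intro foldr_cancel_Cons_closed) auto
  then show ?case
    using Cons assms(3) by (simp add: foldr_cancel_Cons_cancel[where n = n])
qed simp

lemma reduced_words_letters: "w \<in> reduced_words n \<Longrightarrow> fst ` set w \<subseteq> {1..n}"
  by (simp add: reduced_words_def)

lemma foldr_cancel_Cons_Nil: "w \<in> reduced_words n \<Longrightarrow> foldr cancel_Cons w [] = w"
  by (induction w) (auto simp: reduced_words_Cons cancel_Cons_def)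

lemma foldr_cancel_Cons_inverse:
  assumes "w \<in> reduced_words n" "fst ` set u \<subseteq> {1..n}"
  shows "foldr cancel_Cons (rev (map flip_letter u)) (foldr cancel_Cons u w) = w"
  using assms(2)
proof (induction u)
  case (Cons x u)
  have "foldr cancel_Cons u w \<in> reduced_words n"
    using Cons.prems assms(1) by (intro foldr_cancel_Cons_closed) auto
  then show ?case
    using Cons cancel_Cons_flip[of _ n "flip_letter x"] by simp
qed simp

lemma group_free_group: "group (free_group n)"
proof (rule groupI)
  fix u assume u: "u \<in> carrier (free_group n)"
  let ?v = "foldr cancel_Cons (rev (map flip_letter u)) []"
  have u': "u \<in> reduced_words n"
    using u by (simp add: free_group_def)
  have letters: "fst ` set (rev (map flip_letter u)) \<subseteq> {1..n}"
    using reduced_words_letters[OF u'] by auto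
  have "?v \<in> reduced_words n"
    using letters by (intro foldr_cancel_Cons_closed) auto
  moreover have "foldr cancel_Cons ?v u = []"
    using foldr_cancel_Cons_assoc[OF letters, of "[]" u]
      foldr_cancel_Cons_inverse[of "[]" n u] reduced_words_letters[OF u']
      foldr_cancel_Cons_Nil[OF u'] u' by simp
  ultimately show "\<exists>y\<in>carrier (free_group n). y \<otimes>\<^bsub>free_group n\<^esub> u = \<one>\<^bsub>free_group n\<^esub>"
    by (intro bexI[of _ ?v]) (auto simp: free_group_def)
qed (use reduced_words_letters in
      \<open>simp_all add: free_group_def foldr_cancel_Cons_assoc[where n = n] foldr_cancel_Cons_closed\<close>)

lemma basis_elt_closed: "k \<in> {1..n} \<Longrightarrow> basis_elt k \<in> carrier (free_group n)"
  by (simp add: free_group_def basis_elt_def reduced_words_Cons)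

subsection \<open>Universal property\<close>

definition free_lift :: "('a, 'b) monoid_scheme \<Rightarrow> (nat \<Rightarrow> 'a) \<Rightarrow> letter list \<Rightarrow> 'a"
  where "free_lift G f w =
    foldr (\<lambda>(k, b) g. (if b then f k else inv\<^bsub>G\<^esub> (f k)) \<otimes>\<^bsub>G\<^esub> g) w \<one>\<^bsub>G\<^esub>"

lemma free_lift_simps:
  "free_lift G f [] = \<one>\<^bsub>G\<^esub>"
  "free_lift G f (x # w) =
     (if snd x then f (fst x) else inv\<^bsub>G\<^esub> (f (fst x))) \<otimes>\<^bsub>G\<^esub> free_lift G f w"
  by (auto simp: free_lift_def case_prod_beta)

context
  fixes G :: "('a, 'b) monoid_scheme" and n :: nat and f :: "nat \<Rightarrow> 'a"
  assumes G: "group G" and f: "f \<in> {1..n} \<rightarrow> carrier G"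
begin

lemma free_lift_closed:
  "fst ` set w \<subseteq> {1..n} \<Longrightarrow> free_lift G f w \<in> carrier G"
proof (induction w)
  interpret group G by (rule G)
  case (Cons x w)
  then have "f (fst x) \<in> carrier G"
    using f by auto
  then show ?case
    using Cons by (simp add: free_lift_simps)
qed (simp add: free_lift_simps group.is_monoid[OF G] monoid.one_closed)

lemma free_lift_cancel_Cons:
  assumes "fst x \<in> {1..n}" "w \<in> reduced_words n"
  shows "free_lift G f (cancel_Cons x w) = free_lift G f (x # w)"
proof (cases "w \<noteq> [] \<and> hd w = flip_letter x")
  case True
  interpret group G by (rule G)
  obtain v where v: "w = flip_letter x # v"
    using True by (cases w) auto
  have "free_lift G f v \<in> carrier G"
    using assms by (intro free_lift_closed) (auto simp: v reduced_words_def)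
  moreover have "f (fst x) \<in> carrier G"
    using f assms by auto
  ultimately show ?thesis
    by (simp add: v cancel_Cons_def free_lift_simps m_assoc[symmetric])
qed (auto simp: cancel_Cons_def)

lemma free_lift_hom: "free_lift G f \<in> hom (free_group n) G"
proof (rule homI)
  interpret group G by (rule G)
  fix u v
  assume "u \<in> carrier (free_group n)" and v: "v \<in> carrier (free_group n)"
  then have "fst ` set u \<subseteq> {1..n}" "v \<in> reduced_words n"
    by (auto simp: free_group_def reduced_words_def)
  then have "free_lift G f (foldr cancel_Cons u v) = free_lift G f u \<otimes>\<^bsub>G\<^esub> free_lift G f v"
  proof (induction u)
    case Nil
    then show ?case
      using free_lift_closed[OF reduced_words_letters[of v]] by (simp add: free_lift_simps)
  next
    case (Cons x u)
    have "foldr cancel_Cons u v \<in> reduced_words n"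
      using Cons.prems by (intro foldr_cancel_Cons_closed) auto
    moreover have "f (fst x) \<in> carrier G" "free_lift G f u \<in> carrier G"
      "free_lift G f v \<in> carrier G"
      using f Cons.prems by (auto intro!: free_lift_closed simp: reduced_words_def)
    ultimately show ?case
      using Cons by (simp add: free_lift_cancel_Cons free_lift_simps m_assoc)
  qed
  then show "free_lift G f (u \<otimes>\<^bsub>free_group n\<^esub> v) = free_lift G f u \<otimes>\<^bsub>G\<^esub> free_lift G f v"
    by (simp add: free_group_def)
qed (auto simp: free_group_def intro!: free_lift_closed reduced_words_letters)

lemma free_lift_basis_elt: "k \<in> {1..n} \<Longrightarrow> free_lift G f (basis_elt k) = f k"
  using f G by (auto simp: basis_elt_def free_lift_simps Pi_iff group.is_monoid monoid.r_one)

lemma free_lift_unique: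
  assumes h: "h \<in> hom (free_group n) G" and hf: "\<And>k. k \<in> {1..n} \<Longrightarrow> h (basis_elt k) = f k"
    and w: "w \<in> carrier (free_group n)"
  shows "h w = free_lift G f w"
proof -
  interpret h: group_hom "free_group n" G h
    using h G group_free_group by (simp add: group_hom_def group_hom_axioms_def)
  have letter: "h [x] = (if snd x then f (fst x) else inv\<^bsub>G\<^esub> (f (fst x)))"
    if x: "fst x \<in> {1..n}" for x
  proof (cases "snd x")
    case True
    then show ?thesis
      using hf[OF x] by (cases x) (auto simp: basis_elt_def)
  next
    case False
    then have "[x] = inv\<^bsub>free_group n\<^esub> (basis_elt (fst x))"
      using x by (intro h.G.inv_equality[symmetric])
        (auto simp: free_group_def basis_elt_def reduced_words_Cons cancel_Cons_def
           flip_letter_def prod_eq_iff)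
    then have "h [x] = inv\<^bsub>G\<^esub> (h (basis_elt (fst x)))"
      using basis_elt_closed[OF x] by simp
    then show ?thesis
      using False hf[OF x] by simp
  qed
  have "w \<in> reduced_words n"
    using w by (simp add: free_group_def)
  then show ?thesis
  proof (induction w)
    case Nil
    then show ?case
      using h.hom_one by (simp add: free_lift_simps free_group_def)
  next
    case (Cons x w)
    then have xw: "fst x \<in> {1..n}" "w \<in> reduced_words n" "cancel_Cons x w = x # w"
      by (auto simp: reduced_words_Cons cancel_Cons_def)
    then have "h ([x] \<otimes>\<^bsub>free_group n\<^esub> w) = h [x] \<otimes>\<^bsub>G\<^esub> h w"
      by (intro h.hom_mult) (auto simp: free_group_def reduced_words_Cons)
    then show ?case
      using Cons.IH xw letter[of x] by (simp add: free_lift_simps free_group_def)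
  qed
qed

end

section \<open>Nielsen transformations\<close>

definition free_endo :: "nat \<Rightarrow> (nat \<Rightarrow> letter list) \<Rightarrow> letter list \<Rightarrow> letter list"
  where "free_endo n f = restrict (free_lift (free_group n) f) (carrier (free_group n))"

definition nielsen_left :: "nat \<Rightarrow> nat \<Rightarrow> nat \<Rightarrow> letter list \<Rightarrow> letter list"
  where "nielsen_left n i j =
    free_endo n (basis_elt(i := basis_elt j \<otimes>\<^bsub>free_group n\<^esub> basis_elt i))"

definition nielsen_right :: "nat \<Rightarrow> nat \<Rightarrow> nat \<Rightarrow> letter list \<Rightarrow> letter list"
  where "nielsen_right n i j =
    free_endo n (basis_elt(i := basis_elt i \<otimes>\<^bsub>free_group n\<^esub> basis_elt j))"

definition nielsen_transformations :: "nat \<Rightarrow> (letter list \<Rightarrow> letter list) set"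
  where "nielsen_transformations n =
    {nielsen_left n i j | i j. i \<in> {1..n} \<and> j \<in> {1..n} \<and> i \<noteq> j} \<union>
    {nielsen_right n i j | i j. i \<in> {1..n} \<and> j \<in> {1..n} \<and> i \<noteq> j}"

lemma free_endo_hom:
  assumes "f \<in> {1..n} \<rightarrow> carrier (free_group n)"
  shows "free_endo n f \<in> hom (free_group n) (free_group n)"
proof -
  interpret group "free_group n" by (rule group_free_group)
  show ?thesis
    using free_lift_hom[OF group_free_group assms]
    by (auto simp: hom_def free_endo_def)
qed

lemma free_endo_basis_elt:
  assumes "f \<in> {1..n} \<rightarrow> carrier (free_group n)" "k \<in> {1..n}"
  shows "free_endo n f (basis_elt k) = f k"
  using assms free_lift_basis_elt[OF group_free_group assms]
  by (simp add: free_endo_def basis_elt_closed)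

lemma free_endo_left_inverse:
  assumes f: "f \<in> {1..n} \<rightarrow> carrier (free_group n)"
    and g: "g \<in> {1..n} \<rightarrow> carrier (free_group n)"
    and gf: "\<And>k. k \<in> {1..n} \<Longrightarrow> free_endo n g (f k) = basis_elt k"
    and w: "w \<in> carrier (free_group n)"
  shows "free_endo n g (free_endo n f w) = w"
proof -
  have b: "basis_elt \<in> {1..n} \<rightarrow> carrier (free_group n)"
    using basis_elt_closed by auto
  have "(free_endo n g \<circ> free_endo n f) w = free_lift (free_group n) basis_elt w"
  proof (rule free_lift_unique[OF group_free_group b _ _ w])
    show "free_endo n g \<circ> free_endo n f \<in> hom (free_group n) (free_group n)"
      using free_endo_hom[OF f] free_endo_hom[OF g] by (rule hom_compose)
  qed (simp add: free_endo_basis_elt[OF f] gf)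
  moreover have "w = free_lift (free_group n) basis_elt w"
    using free_lift_unique[OF group_free_group b _ _ w, of "\<lambda>x. x"]
    by (simp add: hom_def)
  ultimately show ?thesis by simp
qed

lemma free_endo_auto:
  assumes f: "f \<in> {1..n} \<rightarrow> carrier (free_group n)"
    and g: "g \<in> {1..n} \<rightarrow> carrier (free_group n)"
    and "\<And>k. k \<in> {1..n} \<Longrightarrow> free_endo n g (f k) = basis_elt k"
    and "\<And>k. k \<in> {1..n} \<Longrightarrow> free_endo n f (g k) = basis_elt k"
  shows "free_endo n f \<in> carrier (AutoGroup (free_group n))"
proof -
  have "bij_betw (free_endo n f) (carrier (free_group n)) (carrier (free_group n))"
    using free_endo_hom[OF f] free_endo_hom[OF g] assms
    by (intro bij_betwI[where g = "free_endo n g"] free_endo_left_inverse[OF f g]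
        free_endo_left_inverse[OF g f]) (auto simp: hom_def)
  then show ?thesis
    using free_endo_hom[OF f]
    by (simp add: AutoGroup_def auto_def Bij_def free_endo_def)
qed

lemma nielsen_left_auto:
  assumes ij: "i \<in> {1..n}" "j \<in> {1..n}" "i \<noteq> j"
  shows "nielsen_left n i j \<in> carrier (AutoGroup (free_group n))"
proof -
  interpret group "free_group n" by (rule group_free_group)
  define f where "f = basis_elt(i := basis_elt j \<otimes>\<^bsub>free_group n\<^esub> basis_elt i)"
  define g where "g = basis_elt(i := inv\<^bsub>free_group n\<^esub> basis_elt j \<otimes>\<^bsub>free_group n\<^esub> basis_elt i)"
  have fg: "f \<in> {1..n} \<rightarrow> carrier (free_group n)" "g \<in> {1..n} \<rightarrow> carrier (free_group n)"
    using ij by (auto simp: f_def g_def basis_elt_closed)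
  interpret f: group_hom "free_group n" "free_group n" "free_endo n f"
    using free_endo_hom[OF fg(1)] by unfold_locales
  interpret g: group_hom "free_group n" "free_group n" "free_endo n g"
    using free_endo_hom[OF fg(2)] by unfold_locales
  note [simp] = free_endo_basis_elt[OF fg(1)] free_endo_basis_elt[OF fg(2)]
  have "free_endo n f \<in> carrier (AutoGroup (free_group n))"
    using ij basis_elt_closed[OF ij(1)] basis_elt_closed[OF ij(2)]
    by (intro free_endo_auto[OF fg])
      (auto simp: f_def[THEN fun_cong] g_def[THEN fun_cong] basis_elt_closed m_assoc[symmetric])
  then show ?thesis
    by (simp add: nielsen_left_def f_def)
qed

lemma nielsen_right_auto:
  assumes ij: "i \<in> {1..n}" "j \<in> {1..n}" "i \<noteq> j"
  shows "nielsen_right n i j \<in> carrier (AutoGroup (free_group n))"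
proof -
  interpret group "free_group n" by (rule group_free_group)
  define f where "f = basis_elt(i := basis_elt i \<otimes>\<^bsub>free_group n\<^esub> basis_elt j)"
  define g where "g = basis_elt(i := basis_elt i \<otimes>\<^bsub>free_group n\<^esub> inv\<^bsub>free_group n\<^esub> basis_elt j)"
  have fg: "f \<in> {1..n} \<rightarrow> carrier (free_group n)" "g \<in> {1..n} \<rightarrow> carrier (free_group n)"
    using ij by (auto simp: f_def g_def basis_elt_closed)
  interpret f: group_hom "free_group n" "free_group n" "free_endo n f"
    using free_endo_hom[OF fg(1)] by unfold_locales
  interpret g: group_hom "free_group n" "free_group n" "free_endo n g"
    using free_endo_hom[OF fg(2)] by unfold_locales
  note [simp] = free_endo_basis_elt[OF fg(1)] free_endo_basis_elt[OF fg(2)]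
  have "free_endo n f \<in> carrier (AutoGroup (free_group n))"
    using ij basis_elt_closed[OF ij(1)] basis_elt_closed[OF ij(2)]
    by (intro free_endo_auto[OF fg])
      (auto simp: f_def[THEN fun_cong] g_def[THEN fun_cong] basis_elt_closed m_assoc)
  then show ?thesis
    by (simp add: nielsen_right_def f_def)
qed

lemma nielsen_transformations_auto:
  "nielsen_transformations n \<subseteq> carrier (AutoGroup (free_group n))"
  using nielsen_left_auto nielsen_right_auto unfolding nielsen_transformations_def by blast

lemma nielsen_basis_elt:
  assumes "i \<in> {1..n}" "j \<in> {1..n}" "k \<in> {1..n}"
  shows "nielsen_left n i j (basis_elt k) =
      (if k = i then basis_elt j \<otimes>\<^bsub>free_group n\<^esub> basis_elt i else basis_elt k)"
    and "nielsen_right n i j (basis_elt k) =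
      (if k = i then basis_elt i \<otimes>\<^bsub>free_group n\<^esub> basis_elt j else basis_elt k)"
proof -
  interpret group "free_group n" by (rule group_free_group)
  show "nielsen_left n i j (basis_elt k) =
      (if k = i then basis_elt j \<otimes>\<^bsub>free_group n\<^esub> basis_elt i else basis_elt k)"
    "nielsen_right n i j (basis_elt k) =
      (if k = i then basis_elt i \<otimes>\<^bsub>free_group n\<^esub> basis_elt j else basis_elt k)"
    using assms unfolding nielsen_left_def nielsen_right_def
    by (subst free_endo_basis_elt; auto simp: basis_elt_closed)+
qed

section \<open>CAT(0) spaces\<close>

context Metric_space
begin

definition geodesic_path :: "(real \<Rightarrow> 'a) \<Rightarrow> 'a \<Rightarrow> 'a \<Rightarrow> bool"
  where "geodesic_path c x y \<longleftrightarrow>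
    c ` {0..d x y} \<subseteq> M \<and> c 0 = x \<and> c (d x y) = y \<and>
    (\<forall>s\<in>{0..d x y}. \<forall>t\<in>{0..d x y}. d (c s) (c t) = \<bar>s - t\<bar>)"

definition geodesic_segment :: "'a set \<Rightarrow> 'a \<Rightarrow> 'a \<Rightarrow> bool"
  where "geodesic_segment S x y \<longleftrightarrow> (\<exists>c. geodesic_path c x y \<and> S = c ` {0..d x y})"

definition comparison_point ::
    "'a set \<Rightarrow> 'a \<Rightarrow> real^2 \<Rightarrow> real^2 \<Rightarrow> 'a \<Rightarrow> real^2 \<Rightarrow> bool"
  \<comment> \<open>\<open>x'\<close> on the Euclidean segment from \<open>p'\<close> to \<open>q'\<close> corresponds to \<open>x\<close> on the geodesic
    segment \<open>S\<close> issuing from \<open>p\<close>\<close>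
  where "comparison_point S p p' q' x x' \<longleftrightarrow>
    x \<in> S \<and> x' \<in> closed_segment p' q' \<and> dist p' x' = d p x"

text \<open>
  A point lying on several sides of a geodesic triangle may have several comparison points;
  the inequality is required for all of them.
\<close>

definition triangle_comparison_point ::
    "'a \<Rightarrow> 'a \<Rightarrow> 'a \<Rightarrow> 'a set \<Rightarrow> 'a set \<Rightarrow> 'a set \<Rightarrow>
     real^2 \<Rightarrow> real^2 \<Rightarrow> real^2 \<Rightarrow> 'a \<Rightarrow> real^2 \<Rightarrow> bool"
  where "triangle_comparison_point p q r Spq Sqr Srp p' q' r' x x' \<longleftrightarrow>
    comparison_point Spq p p' q' x x' \<or>
    comparison_point Sqr q q' r' x x' \<or>
    comparison_point Srp r r' p' x x'"

definition CAT0_inequality :: "'a \<Rightarrow> 'a \<Rightarrow> 'a \<Rightarrow> 'a set \<Rightarrow> 'a set \<Rightarrow> 'a set \<Rightarrow> bool"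
  where "CAT0_inequality p q r Spq Sqr Srp \<longleftrightarrow>
    (\<forall>p' q' r' :: real^2.
       dist p' q' = d p q \<and> dist q' r' = d q r \<and> dist r' p' = d r p \<longrightarrow>
       (\<forall>x y x' y'.
          triangle_comparison_point p q r Spq Sqr Srp p' q' r' x x' \<and>
          triangle_comparison_point p q r Spq Sqr Srp p' q' r' y y' \<longrightarrow>
          d x y \<le> dist x' y'))"

end

locale CAT0_space = Metric_space +
  assumes geodesic: "\<And>x y. x \<in> M \<Longrightarrow> y \<in> M \<Longrightarrow> \<exists>c. geodesic_path c x y"
    and CAT0: "\<And>p q r Spq Sqr Srp.
      p \<in> M \<Longrightarrow> q \<in> M \<Longrightarrow> r \<in> M \<Longrightarrow>
      geodesic_segment Spq p q \<Longrightarrow> geodesic_segment Sqr q r \<Longrightarrow> geodesic_segment Srp r p \<Longrightarrow>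
      CAT0_inequality p q r Spq Sqr Srp"

section \<open>Semisimple isometric actions\<close>

context Metric_space
begin

definition is_isometry :: "('a \<Rightarrow> 'a) \<Rightarrow> bool"
  where "is_isometry \<gamma> \<longleftrightarrow>
    bij_betw \<gamma> M M \<and> (\<forall>x\<in>M. \<forall>y\<in>M. d (\<gamma> x) (\<gamma> y) = d x y)"

definition translation_length :: "('a \<Rightarrow> 'a) \<Rightarrow> real"
  where "translation_length \<gamma> = (INF x\<in>M. d x (\<gamma> x))"

definition Min_set :: "('a \<Rightarrow> 'a) \<Rightarrow> 'a set"
  where "Min_set \<gamma> = {x \<in> M. d x (\<gamma> x) = translation_length \<gamma>}"

definition semisimple :: "('a \<Rightarrow> 'a) \<Rightarrow> bool"
  where "semisimple \<gamma> \<longleftrightarrow> is_isometry \<gamma> \<and> Min_set \<gamma> \<noteq> {}"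

end

definition semisimple_action ::
    "('g, 'b) monoid_scheme \<Rightarrow> 'a set \<Rightarrow> ('a \<Rightarrow> 'a \<Rightarrow> real) \<Rightarrow> ('g \<Rightarrow> 'a \<Rightarrow> 'a) \<Rightarrow> bool"
  where "semisimple_action G X d \<phi> \<longleftrightarrow>
    group_action G X \<phi> \<and> (\<forall>g\<in>carrier G. Metric_space.semisimple X d (\<phi> g))"

end

theory Submission
  imports Defs "HOL-Algebra.Generated_Groups"
begin

text \<open>
  The theorem follows from two facts about a Nielsen transformation \<open>\<nu>\<close> and its centralizer \<open>C\<close>.

  Geometry: a semisimple isometry \<open>\<gamma>\<close> that is a product of commutators of elements commuting with
  it has a fixed point. A hyperbolic isometry translates along axes, and measuring how far elements
  of its centralizer move along an axis is a homomorphism to the reals that does not vanish on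
  \<open>\<gamma>\<close>; a homomorphism to an abelian group kills commutators. The proof below
  (\<open>semisimple_in_derived_centralizer_fixes_point\<close>) avoids axes and product decompositions: a
  coarse version of the homomorphism, additive up to bounded errors, is read off from squared
  distances with the inequality that in a quadrilateral the squares of the diagonals sum to at most
  the squares of the sides (\<open>quadrilateral_inequality\<close>). It bounds \<open>(d x (\<gamma>\<^sup>k x))\<^sup>2\<close> by a multiple of
  \<open>k\<close>, while the halving of displacements at midpoints (\<open>halve_displacement\<close>) makes \<open>d x (\<gamma>\<^sup>k x)\<close> at
  least \<open>k\<close> times the translation length when \<open>k\<close> is a power of two.

  Algebra: if \<open>n \<ge> 4\<close>, then \<open>\<nu>\<close> lies in the derived subgroup of \<open>C\<close>
  (\<open>nielsen_in_derived_centralizer\<close>). Take \<open>i, j, k, l\<close> distinct and \<open>\<nu> = \<lambda>\<^sub>i\<^sub>j\<close>. Let \<open>c(w)\<close> denote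
  conjugation by \<open>w\<close> on the free factor generated by \<open>a\<^sub>i, a\<^sub>j, a\<^sub>k\<close>, extended by the identity. Then
  \<open>c(a\<^sub>j) = \<lambda>\<^sub>i\<^sub>j \<rho>\<^sub>i\<^sub>j\<inverse> \<lambda>\<^sub>k\<^sub>j \<rho>\<^sub>k\<^sub>j\<inverse>\<close>. It is a commutator of \<open>\<lambda>\<^sub>k\<^sub>j\<close> and \<open>c(a\<^sub>k)\<close>, both of which commute
  with \<open>\<nu>\<close>, the second because \<open>\<nu>\<close> preserves this free factor and fixes \<open>a\<^sub>k\<close>. Also \<open>\<rho>\<^sub>i\<^sub>j\<close> is a
  commutator of \<open>\<rho>\<^sub>i\<^sub>k\<close> and \<open>\<rho>\<^sub>k\<^sub>j\<close>, and \<open>\<lambda>\<^sub>k\<^sub>j\<close>, \<open>\<rho>\<^sub>k\<^sub>j\<close> are commutators of multiplications involving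
  only the indices \<open>k, l, j\<close>; all of these lie in \<open>C\<close>.
  Solving for \<open>\<lambda>\<^sub>i\<^sub>j\<close> gives the claim, and \<open>\<rho>\<^sub>i\<^sub>j\<close> is treated in the same way.
\<close>

section \<open>Centralizers and derived subgroups\<close>

definition centralizer :: "('a, 'b) monoid_scheme \<Rightarrow> 'a \<Rightarrow> 'a set"
  where "centralizer G g = {h \<in> carrier G. h \<otimes>\<^bsub>G\<^esub> g = g \<otimes>\<^bsub>G\<^esub> h}"

lemma (in group) subgroup_centralizer:
  assumes g: "g \<in> carrier G"
  shows "subgroup (centralizer G g) G"
proof (rule subgroupI)
  fix a assume a: "a \<in> centralizer G g"
  then have "a \<in> carrier G" "a \<otimes> g = g \<otimes> a" by (auto simp: centralizer_def)
  then have "inv a \<otimes> g = g \<otimes> inv a"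
    using g by (metis inv_closed inv_solve_left inv_solve_right m_assoc m_closed)
  then show "inv a \<in> centralizer G g"
    using \<open>a \<in> carrier G\<close> by (simp add: centralizer_def)
next
  fix a b assume "a \<in> centralizer G g" "b \<in> centralizer G g"
  then have "a \<in> carrier G" "a \<otimes> g = g \<otimes> a" "b \<in> carrier G" "b \<otimes> g = g \<otimes> b"
    by (auto simp: centralizer_def)
  then show "a \<otimes> b \<in> centralizer G g"
    using g by (simp add: centralizer_def) (metis m_assoc)
next
  have "\<one> \<in> centralizer G g" using g by (simp add: centralizer_def)
  then show "centralizer G g \<noteq> {}" by auto
qed (auto simp: centralizer_def)

lemma (in group) inv_mult_cancel:
  assumes "x \<in> carrier G" "y \<in> carrier G"
  shows "inv x \<otimes> (x \<otimes> y) = y" "x \<otimes> (inv x \<otimes> y) = y"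
  using assms by (simp_all flip: m_assoc)

text \<open>
  Recognizing commutators by identities without inverses spares computing the inverses of
  automorphisms.
\<close>

lemma (in group) commutator_in_derived:
  assumes H: "subgroup H G" and ab: "a \<in> H" "b \<in> H" and z: "z \<in> carrier G"
  shows "b \<otimes> a = z \<otimes> a \<otimes> b \<Longrightarrow> z \<in> derived G H"
    and "b \<otimes> a = a \<otimes> b \<otimes> z \<Longrightarrow> z \<in> derived G H"
proof -
  interpret H: subgroup H G by (rule H)
  have abG: "a \<in> carrier G" "b \<in> carrier G" using ab by auto
  have comm: "g \<otimes> h \<otimes> inv g \<otimes> inv h \<in> derived G H" if "g \<in> H" "h \<in> H" for g h
    using that unfolding derived_def by (blast intro: generate.incl)
  show "z \<in> derived G H" if "b \<otimes> a = z \<otimes> a \<otimes> b"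
  proof -
    have "z = b \<otimes> a \<otimes> inv (a \<otimes> b)"
      using that abG z by (simp add: m_assoc inv_solve_right)
    then have "z = b \<otimes> a \<otimes> inv b \<otimes> inv a"
      using abG by (simp add: inv_mult_group m_assoc)
    then show ?thesis using comm[OF ab(2,1)] by simp
  qed
  show "z \<in> derived G H" if "b \<otimes> a = a \<otimes> b \<otimes> z"
  proof -
    have "z = inv (a \<otimes> b) \<otimes> (b \<otimes> a)"
      using that abG z by (simp add: inv_solve_left)
    then have "z = inv b \<otimes> inv a \<otimes> inv (inv b) \<otimes> inv (inv a)"
      using abG by (simp add: inv_mult_group m_assoc)
    then show ?thesis using comm[of "inv b" "inv a"] ab by simp
  qed
qed

text \<open>
  Modulo bounded sequences \<open>F\<close> is a homomorphism from \<open>H\<close> to an abelian group, so it kills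
  commutators. The bound on the defect may depend on the two elements, but not on \<open>k\<close>.
\<close>

lemma (in group) quasi_additive_bounded_on_derived:
  fixes F :: "'a \<Rightarrow> nat \<Rightarrow> real"
  assumes H: "subgroup H G"
    and F: "\<And>g h. g \<in> H \<Longrightarrow> h \<in> H \<Longrightarrow> bounded (range (\<lambda>k. F (g \<otimes> h) k - (F g k + F h k)))"
    and z: "z \<in> derived G H"
  shows "bounded (range (F z))"
proof -
  interpret H: subgroup H G by (rule H)
  have add: "bounded (range (\<lambda>k. a k + b k))" if "bounded (range a)" "bounded (range b)"
    for a b :: "nat \<Rightarrow> real"
    using bounded_plus_comp[OF that] .
  have diff: "bounded (range (\<lambda>k. a k - b k))" if "bounded (range a)" "bounded (range b)"
    for a b :: "nat \<Rightarrow> real"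
    using bounded_minus_comp[OF that] .
  have mult: "bounded (range (F (g \<otimes> h)))"
    if "g \<in> H" "h \<in> H" "bounded (range (\<lambda>k. F g k + F h k))" for g h
    using add[OF F[OF that(1,2)] that(3)] by simp
  have one: "bounded (range (F \<one>))"
    using diff[OF _ F[of \<one> \<one>], of "\<lambda>k. 0"] by simp
  have inv: "bounded (range (\<lambda>k. F g k + F (inv g) k))" if "g \<in> H" for g
    using diff[OF one F[of g "inv g"]] that by simp
  have bounded_inv: "bounded (range (F (inv g)))" if "g \<in> H" "bounded (range (F g))" for g
    using diff[OF inv[OF that(1)] that(2)] by simp
  have commutator: "bounded (range (F (g \<otimes> h \<otimes> inv g \<otimes> inv h)))"
    if gh: "g \<in> H" "h \<in> H" for g h
  proof -
    have "bounded (range (\<lambda>k. F (g \<otimes> h \<otimes> inv g \<otimes> inv h) k -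
        (F g k + F h k + F (inv g) k + F (inv h) k)))"
      using add[OF add[OF F[of "g \<otimes> h \<otimes> inv g" "inv h"] F[of "g \<otimes> h" "inv g"]] F[of g h]] gh
      by (simp add: algebra_simps)
    from add[OF this add[OF inv[OF gh(1)] inv[OF gh(2)]]] show ?thesis
      by (simp add: algebra_simps)
  qed
  have "z \<in> H \<and> bounded (range (F z))"
    using z unfolding derived_def
  proof (induction rule: generate.induct)
    case one
    then show ?case using \<open>bounded (range (F \<one>))\<close> by simp
  next
    case (incl h)
    then show ?case using commutator by auto
  next
    case (inv h)
    then have "h \<in> H" "bounded (range (F h))" using commutator by auto
    then show ?case using bounded_inv by auto
  next
    case (eng h1 h2)
    then show ?case using mult add by auto
  qed
  then show ?thesis ..
qed

section \<open>Midpoints in CAT(0) spaces\<close>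

text \<open>
  For \<open>a \<noteq> 0\<close> the vertices are \<open>(0, 0)\<close>, \<open>(a, 0)\<close> and \<open>(u, sqrt (c\<^sup>2 - u\<^sup>2))\<close>, where \<open>u\<close> is given by
  the law of cosines; the triangle inequalities amount to \<open>\<bar>u\<bar> \<le> c\<close>.
\<close>

lemma comparison_triangle_exists:
  fixes a b c :: real
  assumes "0 \<le> a" "0 \<le> b" "0 \<le> c" "a \<le> b + c" "b \<le> a + c" "c \<le> a + b"
  shows "\<exists>p q r :: real^2. dist p q = a \<and> dist q r = b \<and> dist r p = c"
proof (cases "a = 0")
  case True
  then show ?thesis
    using assms by (intro exI[of _ 0] exI[of _ "vector [c, 0]"])
      (auto simp: dist_norm norm_vec_def L2_set_def sum_2)
next
  case False
  define u where "u = (a\<^sup>2 + c\<^sup>2 - b\<^sup>2) / (2 * a)"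
  have "a\<^sup>2 + c\<^sup>2 - b\<^sup>2 \<le> 2 * a * c"
  proof -
    have "\<bar>a - c\<bar> \<le> b" using assms by auto
    then have "(a - c)\<^sup>2 \<le> b\<^sup>2" using assms(2) by (metis power2_abs abs_ge_zero power_mono)
    then show ?thesis by (simp add: power2_diff)
  qed
  moreover have "- (2 * a * c) \<le> a\<^sup>2 + c\<^sup>2 - b\<^sup>2"
  proof -
    have "b\<^sup>2 \<le> (a + c)\<^sup>2" using assms by (intro power_mono) auto
    then show ?thesis by (simp add: power2_sum)
  qed
  ultimately have "u \<le> c" "- c \<le> u"
    using False assms(1) by (auto simp: u_def field_simps)
  then have "u\<^sup>2 \<le> c\<^sup>2" by (metis abs_le_iff minus_le_iff power2_abs abs_ge_zero power_mono)
  moreover have "2 * a * u = a\<^sup>2 + c\<^sup>2 - b\<^sup>2" using False by (simp add: u_def)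
  then have "(a - u)\<^sup>2 + (c\<^sup>2 - u\<^sup>2) = b\<^sup>2"
    by (simp add: power2_diff)
  ultimately show ?thesis
    using assms
    by (intro exI[of _ 0] exI[of _ "vector [a, 0]"] exI[of _ "vector [u, sqrt (c\<^sup>2 - u\<^sup>2)]"])
      (auto simp: dist_norm norm_vec_def L2_set_def sum_2)
qed

lemma dist_midpoint_squared:
  fixes p q r :: "'v :: real_inner"
  shows "(dist (midpoint p q) r)\<^sup>2 = ((dist r p)\<^sup>2 + (dist q r)\<^sup>2) / 2 - (dist p q)\<^sup>2 / 4"
proof -
  have "midpoint p q - r = (1 / 2) *\<^sub>R ((p - r) + (q - r))"
    by (simp add: midpoint_def algebra_simps flip: scaleR_add_left)
  then have "4 * (dist (midpoint p q) r)\<^sup>2 = (norm ((p - r) + (q - r)))\<^sup>2"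
    by (simp add: dist_norm power_divide)
  moreover have "(norm ((p - r) + (q - r)))\<^sup>2 + (norm ((p - r) - (q - r)))\<^sup>2
      = 2 * (norm (p - r))\<^sup>2 + 2 * (norm (q - r))\<^sup>2"
    by (simp add: power2_norm_eq_inner inner_commute algebra_simps)
  ultimately show ?thesis
    by (simp add: dist_norm norm_minus_commute[of r p] field_simps)
qed

context Metric_space
begin

text \<open>
  A midpoint together with the Bruhat--Tits (CN) inequality that compares it with the Euclidean
  midpoint formula. The existence of such points is the form in which \<open>CAT(0)\<close> geometry enters.
\<close>

definition cn_midpoint :: "'a \<Rightarrow> 'a \<Rightarrow> 'a \<Rightarrow> bool"
  where "cn_midpoint x y m \<longleftrightarrow> m \<in> M \<and>
    (\<forall>z\<in>M. (d z m)\<^sup>2 \<le> ((d z x)\<^sup>2 + (d z y)\<^sup>2) / 2 - (d x y)\<^sup>2 / 4)"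

end

context CAT0_space
begin

text \<open>
  The comparison inequality for the third vertex of a triangle and the midpoint of the opposite
  side is the CN inequality.
\<close>

lemma cn_midpoint_exists:
  assumes x: "x \<in> M" and y: "y \<in> M"
  shows "\<exists>m. cn_midpoint x y m"
proof -
  obtain c where c: "geodesic_path c x y" using geodesic x y by blast
  define m where "m = c (d x y / 2)"
  have m: "m \<in> M" "m \<in> c ` {0..d x y}" "d x m = d x y / 2"
    using c by (auto simp: geodesic_path_def m_def)
  have "(d z m)\<^sup>2 \<le> ((d z x)\<^sup>2 + (d z y)\<^sup>2) / 2 - (d x y)\<^sup>2 / 4" if z: "z \<in> M" for z
  proof -
    obtain c1 c2 where c1: "geodesic_path c1 y z" and c2: "geodesic_path c2 z x"
      using geodesic x y z by blast
    have "d y z \<le> d x y + d z x" "d x y \<le> d y z + d z x" "d z x \<le> d x y + d y z"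
      using triangle[of y x z] triangle[of x z y] triangle[of z y x] x y z
      by (simp_all add: commute)
    then obtain p q r :: "real^2" where pqr: "dist p q = d x y" "dist q r = d y z" "dist r p = d z x"
      using comparison_triangle_exists[of "d x y" "d y z" "d z x"] by auto
    have "z \<in> c2 ` {0..d z x}" using c2 by (force simp: geodesic_path_def)
    then have tcp: "triangle_comparison_point x y z (c ` {0..d x y}) (c1 ` {0..d y z})
        (c2 ` {0..d z x}) p q r z r"
      using z by (simp add: triangle_comparison_point_def comparison_point_def)
    have "dist p (midpoint p q) = d x m"
      by (simp add: dist_midpoint pqr m)
    then have "triangle_comparison_point x y z (c ` {0..d x y}) (c1 ` {0..d y z})
        (c2 ` {0..d z x}) p q r m (midpoint p q)"
      using m
      by (simp add: triangle_comparison_point_def comparison_point_def midpoint_in_closed_segment)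
    moreover have "CAT0_inequality x y z (c ` {0..d x y}) (c1 ` {0..d y z}) (c2 ` {0..d z x})"
      using x y z c c1 c2 by (intro CAT0) (auto simp: geodesic_segment_def)
    ultimately have "d m z \<le> dist (midpoint p q) r"
      using tcp pqr unfolding CAT0_inequality_def by blast
    then have "(d m z)\<^sup>2 \<le> (dist (midpoint p q) r)\<^sup>2" by (intro power_mono) auto
    then show ?thesis
      by (simp add: dist_midpoint_squared pqr commute)
  qed
  then show ?thesis using m unfolding cn_midpoint_def by blast
qed

text \<open>
  The sum of the squares of the two diagonals \<open>x w\<close> and \<open>y z\<close> is at most that of the four sides:
  apply the CN inequality at \<open>x\<close> and at \<open>w\<close> to the midpoint of \<open>y z\<close>. Read as a bound on
  \<open>(d x w)\<^sup>2 - (d y w)\<^sup>2 - (d x z)\<^sup>2 + (d y z)\<^sup>2\<close>, it says that this mixed second difference stays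
  bounded when the pairs \<open>x, y\<close> and \<open>z, w\<close> move away from each other, provided that the distances
  within the two pairs stay bounded.
\<close>

lemma quadrilateral_inequality:
  assumes "x \<in> M" "y \<in> M" "z \<in> M" "w \<in> M"
  shows "(d x w)\<^sup>2 + (d y z)\<^sup>2 \<le> (d x z)\<^sup>2 + (d y w)\<^sup>2 + (d x y)\<^sup>2 + (d z w)\<^sup>2"
proof -
  obtain m where m: "cn_midpoint y z m" using cn_midpoint_exists assms by blast
  have "(d x m)\<^sup>2 \<le> ((d x y)\<^sup>2 + (d x z)\<^sup>2) / 2 - (d y z)\<^sup>2 / 4"
    "(d w m)\<^sup>2 \<le> ((d w y)\<^sup>2 + (d w z)\<^sup>2) / 2 - (d y z)\<^sup>2 / 4"
    using m assms by (auto simp: cn_midpoint_def)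
  moreover have "(d x w)\<^sup>2 \<le> 2 * (d x m)\<^sup>2 + 2 * (d w m)\<^sup>2"
  proof -
    have "(d x w)\<^sup>2 \<le> (d x m + d w m)\<^sup>2"
      using triangle[of x m w] m assms by (intro power_mono) (auto simp: cn_midpoint_def commute)
    also have "\<dots> \<le> 2 * (d x m)\<^sup>2 + 2 * (d w m)\<^sup>2"
      using zero_le_power2[of "d x m - d w m"] by (simp add: power2_eq_square algebra_simps)
    finally show ?thesis .
  qed
  ultimately show ?thesis by (simp add: commute field_simps)
qed

text \<open>
  As in Euclidean geometry, the segment joining the midpoints of two sides of a triangle is at most
  half as long as the third side: apply CN to one midpoint, then to the other.
\<close>

lemma dist_cn_midpoints:
  assumes "x \<in> M" "y \<in> M" "z \<in> M" and m: "cn_midpoint x y m" and m': "cn_midpoint y z m'"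
  shows "d m m' \<le> d x z / 2"
proof -
  have "(d m m')\<^sup>2 \<le> ((d m y)\<^sup>2 + (d m z)\<^sup>2) / 2 - (d y z)\<^sup>2 / 4"
    "(d z m)\<^sup>2 \<le> ((d z x)\<^sup>2 + (d z y)\<^sup>2) / 2 - (d x y)\<^sup>2 / 4"
    "(d y m)\<^sup>2 \<le> (d x y)\<^sup>2 / 4"
    using m m' assms(1-3) by (auto simp: cn_midpoint_def commute dest: bspec[of _ _ y])
  then have "(d m m')\<^sup>2 \<le> (d x z / 2)\<^sup>2"
    by (simp add: commute field_simps)
  then show ?thesis by (auto intro: power2_le_imp_le)
qed

lemma cn_midpoint_isometry:
  assumes g: "is_isometry g" and "x \<in> M" "y \<in> M" and m: "cn_midpoint x y m"
  shows "cn_midpoint (g x) (g y) (g m)"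
proof -
  have gM: "g ` M = M" and gd: "\<And>x y. x \<in> M \<Longrightarrow> y \<in> M \<Longrightarrow> d (g x) (g y) = d x y"
    using g by (auto simp: is_isometry_def bij_betw_def)
  have "(d (g z) (g m))\<^sup>2 \<le> ((d (g z) (g x))\<^sup>2 + (d (g z) (g y))\<^sup>2) / 2 - (d (g x) (g y))\<^sup>2 / 4"
    if "z \<in> M" for z
    using m assms(2,3) that by (simp add: cn_midpoint_def gd)
  then have "\<forall>z\<in>g ` M. (d z (g m))\<^sup>2 \<le> ((d z (g x))\<^sup>2 + (d z (g y))\<^sup>2) / 2 - (d (g x) (g y))\<^sup>2 / 4"
    by blast
  then show ?thesis
    using gM m by (auto simp: cn_midpoint_def)
qed

text \<open>
  The witness is the midpoint of \<open>x\<close> and \<open>g x\<close>. It follows that the translation length of \<open>g\<^sup>2\<close> is at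
  least twice that of \<open>g\<close>, which replaces the existence of an axis.
\<close>

lemma halve_displacement:
  assumes g: "is_isometry g" and x: "x \<in> M"
  shows "\<exists>y\<in>M. d y (g y) \<le> d x (g (g x)) / 2"
proof -
  have gM: "\<And>x. x \<in> M \<Longrightarrow> g x \<in> M"
    using g by (auto simp: is_isometry_def bij_betw_def)
  obtain m where m: "cn_midpoint x (g x) m" using cn_midpoint_exists gM x by blast
  then have "d m (g m) \<le> d x (g (g x)) / 2"
    using dist_cn_midpoints[OF _ _ _ m cn_midpoint_isometry[OF g _ _ m]] gM x by simp
  then show ?thesis using m by (auto simp: cn_midpoint_def)
qed

lemma translation_length_le:
  assumes "g ` M \<subseteq> M" "x \<in> M"
  shows "translation_length g \<le> d x (g x)"
  unfolding translation_length_def using assms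
  by (intro cINF_lower) (auto intro: bdd_belowI[of _ 0])

end

section \<open>A fixed point criterion for semisimple isometries\<close>

text \<open>
  Let \<open>x\<close> be a point of \<open>Min(\<gamma>)\<close>. For \<open>g\<close> in the centralizer of \<open>\<gamma>\<close>, the number
  \<open>F g k = (d x (\<gamma>\<^sup>k g x))\<^sup>2 - (d x (\<gamma>\<^sup>k x))\<^sup>2\<close> is, up to a bounded error, \<open>2 k \<parallel>\<gamma>\<parallel>\<close> times the
  signed distance by which \<open>g\<close> translates along the axes of \<open>\<gamma>\<close> if \<open>\<gamma>\<close> is hyperbolic. The
  quadrilateral inequality shows that it is additive in \<open>g\<close> up to an error independent of \<open>k\<close>.
  If \<open>\<gamma>\<close> is a product of commutators of
  elements of its centralizer, then \<open>F \<gamma> k\<close> is bounded in \<open>k\<close>, and summing over \<open>k\<close> yields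
  \<open>d x (\<gamma>\<^sup>k x) = O(sqrt k)\<close>. On the other hand \<open>d x (\<gamma>\<^sup>k x) \<ge> k \<parallel>\<gamma>\<parallel>\<close> for \<open>k\<close> a power of two.
  Hence \<open>\<parallel>\<gamma>\<parallel> = 0\<close>.
\<close>

lemma semisimple_in_derived_centralizer_fixes_point:
  fixes G :: "('g, 'b) monoid_scheme" (structure) and X :: "'a set"
  assumes X: "CAT0_space X d" and act: "group_action G X \<phi>"
    and isom: "\<And>g. g \<in> carrier G \<Longrightarrow> Metric_space.is_isometry X d (\<phi> g)"
    and \<gamma>: "\<gamma> \<in> derived G (centralizer G \<gamma>)" "\<gamma> \<in> carrier G"
    and ss: "Metric_space.semisimple X d (\<phi> \<gamma>)"
  shows "\<exists>x\<in>X. \<phi> \<gamma> x = x"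
proof -
  interpret CAT0_space X d by (rule X)
  interpret group_action G X \<phi> by (rule act)
  interpret G: group G using group_hom by (simp add: group_hom_def)
  let ?C = "centralizer G \<gamma>"
  have in_X: "\<phi> g x \<in> X" if "g \<in> carrier G" "x \<in> X" for g x
    using isom[OF that(1)] that(2) by (auto simp: is_isometry_def bij_betw_def)
  have dist_eq: "d (\<phi> g x) (\<phi> g y) = d x y" if "g \<in> carrier G" "x \<in> X" "y \<in> X" for g x y
    using isom[OF that(1)] that(2,3) by (auto simp: is_isometry_def)
  obtain x where x: "x \<in> X" and Min: "d x (\<phi> \<gamma> x) = translation_length (\<phi> \<gamma>)"
    using ss by (auto simp: semisimple_def Min_set_def)
  define F where "F g k = (d x (\<phi> (\<gamma> [^] k \<otimes> g) x))\<^sup>2 - (d x (\<phi> (\<gamma> [^] k) x))\<^sup>2" for g and k :: nat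
  have "bounded (range (\<lambda>k. F (g \<otimes> h) k - (F g k + F h k)))"
    if g: "g \<in> ?C" and h: "h \<in> ?C" for g h
  proof -
    have gh: "g \<in> carrier G" "h \<in> carrier G" "g \<otimes> \<gamma> = \<gamma> \<otimes> g"
      using g h by (auto simp: centralizer_def)
    have shift: "d x (\<phi> (\<gamma> [^] k \<otimes> (g \<otimes> u)) x) = d (\<phi> (inv g) x) (\<phi> (\<gamma> [^] k \<otimes> u) x)"
      if u: "u \<in> carrier G" for u and k :: nat
    proof -
      have "\<gamma> [^] k \<otimes> g = g \<otimes> \<gamma> [^] k"
        using G.group_commutes_pow[of \<gamma> g k] gh \<gamma>(2) by simp
      then have "\<gamma> [^] k \<otimes> (g \<otimes> u) = g \<otimes> (\<gamma> [^] k \<otimes> u)"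
        using gh u \<gamma>(2) by (metis G.m_assoc G.nat_pow_closed)
      moreover have "\<phi> (g \<otimes> v) x = \<phi> g (\<phi> v x)" if "v \<in> carrier G" for v
        using composition_rule that gh x by simp
      moreover have "x = \<phi> g (\<phi> (inv g) x)"
        using composition_rule[of x g "inv g"] id_eq_one gh x by (metis G.inv_closed G.r_inv restrict_apply')
      ultimately show ?thesis
        using dist_eq[of g "\<phi> (inv g) x" "\<phi> (\<gamma> [^] k \<otimes> u) x"] gh u \<gamma>(2) in_X x by auto
    qed
    \<comment> \<open>the quadrilateral with the near pair \<open>g\<inverse> x, x\<close> and the far pair \<open>\<gamma>\<^sup>k h x, \<gamma>\<^sup>k x\<close>\<close>
    have "\<bar>F (g \<otimes> h) k - (F g k + F h k)\<bar> \<le> (d (\<phi> (inv g) x) x)\<^sup>2 + (d (\<phi> h x) x)\<^sup>2" for k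
    proof -
      let ?p = "\<phi> (\<gamma> [^] k) x" and ?q = "\<phi> (\<gamma> [^] k \<otimes> h) x" and ?y = "\<phi> (inv g) x"
      have q: "?q = \<phi> (\<gamma> [^] k) (\<phi> h x)"
        using composition_rule gh x \<gamma>(2) by simp
      have M: "?p \<in> X" "?q \<in> X" "?y \<in> X"
        using in_X x gh \<gamma>(2) by auto
      have "d ?q ?p = d (\<phi> h x) x"
        unfolding q using dist_eq in_X x gh \<gamma>(2) by simp
      moreover have "F (g \<otimes> h) k - (F g k + F h k)
          = (d ?y ?q)\<^sup>2 + (d x ?p)\<^sup>2 - ((d ?y ?p)\<^sup>2 + (d x ?q)\<^sup>2)"
        using shift[of h k] shift[of \<one> k] gh \<gamma>(2) by (simp add: F_def)
      ultimately show ?thesis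
        using quadrilateral_inequality[of ?y x ?p ?q] quadrilateral_inequality[of ?y x ?q ?p] x M
        by (simp add: commute)
    qed
    then show ?thesis
      unfolding bounded_iff by auto
  qed
  from G.quasi_additive_bounded_on_derived[OF G.subgroup_centralizer[OF \<gamma>(2)] this \<gamma>(1)]
  obtain K where K: "\<bar>F \<gamma> k\<bar> \<le> K" for k
    unfolding bounded_iff by auto
  then have step: "(d x (\<phi> (\<gamma> [^] Suc k) x))\<^sup>2 \<le> (d x (\<phi> (\<gamma> [^] k) x))\<^sup>2 + K" for k
    using abs_le_D1[OF K[of k]] by (simp add: F_def)
  have linear: "(d x (\<phi> (\<gamma> [^] k) x))\<^sup>2 \<le> real k * K" for k
  proof (induction k)
    case 0
    have "\<phi> \<one> x = x" using id_eq_one x by (metis restrict_apply')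
    then show ?case using x by simp
  next
    case (Suc k)
    then show ?case using step[of k] by (simp add: algebra_simps)
  qed
  define L where "L = translation_length (\<phi> \<gamma>)"
  have L: "L * 2 ^ j \<le> d y (\<phi> (\<gamma> [^] (2 ^ j :: nat)) y)" if "y \<in> X" for y j
    using that
  proof (induction j arbitrary: y)
    case 0
    then show ?case using translation_length_le[of "\<phi> \<gamma>" y] in_X \<gamma>(2) by (auto simp: L_def)
  next
    case (Suc j)
    let ?g = "\<gamma> [^] (2 ^ j :: nat)"
    have "\<phi> (\<gamma> [^] (2 ^ Suc j :: nat)) y = \<phi> ?g (\<phi> ?g y)"
      using composition_rule[of y ?g ?g] Suc.prems \<gamma>(2) by (simp add: G.nat_pow_mult mult_2)
    then obtain z where "z \<in> X" "d z (\<phi> ?g z) \<le> d y (\<phi> (\<gamma> [^] (2 ^ Suc j :: nat)) y) / 2"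
      using halve_displacement[of "\<phi> ?g" y] isom Suc.prems \<gamma>(2) by auto
    then show ?case using Suc.IH[of z] by simp
  qed
  have "L \<ge> 0" using Min by (metis L_def nonneg)
  have "L\<^sup>2 * 2 ^ j \<le> K" for j
  proof -
    have "(L * 2 ^ j)\<^sup>2 \<le> (d x (\<phi> (\<gamma> [^] (2 ^ j :: nat)) x))\<^sup>2"
      using L[OF x] \<open>L \<ge> 0\<close> by (intro power_mono) auto
    also have "\<dots> \<le> 2 ^ j * K" using linear[of "2 ^ j"] by simp
    finally show ?thesis by (simp add: power2_eq_square mult_ac)
  qed
  have "L = 0"
  proof (rule ccontr)
    assume "L \<noteq> 0"
    then obtain j where "K / L\<^sup>2 < 2 ^ j" using real_arch_pow[of 2] by auto
    then have "K < L\<^sup>2 * 2 ^ j" using \<open>L \<noteq> 0\<close> by (simp add: divide_less_eq mult.commute)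
    then show False using \<open>\<And>j. L\<^sup>2 * 2 ^ j \<le> K\<close>[of j] by simp
  qed
  then have "\<phi> \<gamma> x = x"
    using Min x in_X \<gamma>(2) by (metis L_def zero)
  then show ?thesis using x by blast
qed

section \<open>Nielsen transformations in the derived subgroup of their centralizer\<close>

text \<open>
  Conjugation by \<open>a\<^sub>j\<close> on the basis elements with index in \<open>S\<close>. If \<open>j \<notin> S\<close>, then \<open>S\<close> may be enlarged by
  \<open>j\<close> without changing the map, so that \<open>S = {i, k}\<close> gives the inner automorphism of the free factor
  generated by \<open>a\<^sub>i, a\<^sub>j, a\<^sub>k\<close>, extended by the identity.
\<close>

definition partial_conjugation :: "nat \<Rightarrow> nat set \<Rightarrow> nat \<Rightarrow> letter list \<Rightarrow> letter list"
  where "partial_conjugation n S j = free_endo n (\<lambda>m. if m \<in> S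
    then basis_elt j \<otimes>\<^bsub>free_group n\<^esub> basis_elt m \<otimes>\<^bsub>free_group n\<^esub> inv\<^bsub>free_group n\<^esub> basis_elt j
    else basis_elt m)"

context
  fixes n :: nat
begin

interpretation F: group "free_group n"
  by (rule group_free_group)

interpretation A: group "AutoGroup (free_group n)"
  by (rule F.AutoGroup)

lemma partial_conjugation_basis_elt:
  assumes "j \<in> {1..n}" "m \<in> {1..n}"
  shows "partial_conjugation n S j (basis_elt m) = (if m \<in> S
    then basis_elt j \<otimes>\<^bsub>free_group n\<^esub> basis_elt m \<otimes>\<^bsub>free_group n\<^esub> inv\<^bsub>free_group n\<^esub> basis_elt j
    else basis_elt m)"
  using assms unfolding partial_conjugation_def
  by (subst free_endo_basis_elt) (auto simp: basis_elt_closed)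

lemma partial_conjugation_auto:
  assumes "j \<in> {1..n}" "j \<notin> S"
  shows "partial_conjugation n S j \<in> carrier (AutoGroup (free_group n))"
proof -
  define f where "f m = (if m \<in> S
    then basis_elt j \<otimes>\<^bsub>free_group n\<^esub> basis_elt m \<otimes>\<^bsub>free_group n\<^esub> inv\<^bsub>free_group n\<^esub> basis_elt j
    else basis_elt m)" for m
  define g where "g m = (if m \<in> S
    then inv\<^bsub>free_group n\<^esub> basis_elt j \<otimes>\<^bsub>free_group n\<^esub> basis_elt m \<otimes>\<^bsub>free_group n\<^esub> basis_elt j
    else basis_elt m)" for m
  have fg: "f \<in> {1..n} \<rightarrow> carrier (free_group n)" "g \<in> {1..n} \<rightarrow> carrier (free_group n)"
    using assms by (auto simp: f_def g_def basis_elt_closed)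
  interpret f: group_hom "free_group n" "free_group n" "free_endo n f"
    using free_endo_hom[OF fg(1)] by unfold_locales
  interpret g: group_hom "free_group n" "free_group n" "free_endo n g"
    using free_endo_hom[OF fg(2)] by unfold_locales
  note [simp] = free_endo_basis_elt[OF fg(1)] free_endo_basis_elt[OF fg(2)]
  have "free_endo n f \<in> carrier (AutoGroup (free_group n))"
    using assms basis_elt_closed[OF assms(1)]
    by (intro free_endo_auto[OF fg])
      (auto simp: f_def g_def basis_elt_closed F.m_assoc F.inv_mult_cancel)
  then show ?thesis
    by (simp add: partial_conjugation_def f_def[abs_def])
qed

lemma auto_closed:
  assumes "f \<in> carrier (AutoGroup (free_group n))" "u \<in> carrier (free_group n)"
  shows "f u \<in> carrier (free_group n)"
  using assms by (auto simp: AutoGroup_def auto_def hom_def)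

lemma auto_mult:
  assumes "f \<in> carrier (AutoGroup (free_group n))"
    "u \<in> carrier (free_group n)" "v \<in> carrier (free_group n)"
  shows "f (u \<otimes>\<^bsub>free_group n\<^esub> v) = f u \<otimes>\<^bsub>free_group n\<^esub> f v"
  using assms by (auto simp: AutoGroup_def auto_def hom_def)

lemma auto_inv:
  assumes f: "f \<in> carrier (AutoGroup (free_group n))" and u: "u \<in> carrier (free_group n)"
  shows "f (inv\<^bsub>free_group n\<^esub> u) = inv\<^bsub>free_group n\<^esub> f u"
proof -
  have "f \<in> hom (free_group n) (free_group n)"
    using f by (simp add: AutoGroup_def auto_def)
  then interpret f: group_hom "free_group n" "free_group n" f
    by unfold_locales
  show ?thesis using u by (rule f.hom_inv)
qed

lemma auto_compose:
  assumes "f \<in> carrier (AutoGroup (free_group n))" "g \<in> carrier (AutoGroup (free_group n))"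
    "u \<in> carrier (free_group n)"
  shows "(f \<otimes>\<^bsub>AutoGroup (free_group n)\<^esub> g) u = f (g u)"
  using assms by (simp add: AutoGroup_def auto_def BijGroup_def compose_def)

lemma auto_eqI:
  assumes f: "f \<in> carrier (AutoGroup (free_group n))"
    and g: "g \<in> carrier (AutoGroup (free_group n))"
    and eq: "\<And>k. k \<in> {1..n} \<Longrightarrow> f (basis_elt k) = g (basis_elt k)"
  shows "f = g"
proof (rule extensionalityI)
  show "f \<in> extensional (carrier (free_group n))" "g \<in> extensional (carrier (free_group n))"
    using f g by (auto simp: AutoGroup_def auto_def Bij_def)
  have hom: "f \<in> hom (free_group n) (free_group n)" "g \<in> hom (free_group n) (free_group n)"
    using f g by (auto simp: AutoGroup_def auto_def)
  have "(\<lambda>k. g (basis_elt k)) \<in> {1..n} \<rightarrow> carrier (free_group n)"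
    using auto_closed[OF g] basis_elt_closed by auto
  note unique = free_lift_unique[OF group_free_group this]
  show "f u = g u" if "u \<in> carrier (free_group n)" for u
    using unique[OF hom(1) eq that] unique[OF hom(2) refl that] by simp
qed

text \<open>
  In the next two criteria the special indices are listed separately: all equations
  \<open>m = i\<close> are then decided, and the automorphisms are evaluated by rewriting alone.
\<close>

lemma auto_eqI_cases:
  assumes f: "f \<in> carrier (AutoGroup (free_group n))"
    and g: "g \<in> carrier (AutoGroup (free_group n))"
    and "f (basis_elt i) = g (basis_elt i)" "f (basis_elt j) = g (basis_elt j)"
      "f (basis_elt k) = g (basis_elt k)"
    and "\<And>m. m \<in> {1..n} \<Longrightarrow> m \<notin> {i, j, k} \<Longrightarrow> f (basis_elt m) = g (basis_elt m)"
  shows "f = g"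
  using auto_eqI[OF f g] assms(3-6) by blast

lemma in_centralizerI:
  assumes f: "f \<in> carrier (AutoGroup (free_group n))"
    and g: "g \<in> carrier (AutoGroup (free_group n))"
    and "f (g (basis_elt i)) = g (f (basis_elt i))" "f (g (basis_elt j)) = g (f (basis_elt j))"
      "f (g (basis_elt k)) = g (f (basis_elt k))" "f (g (basis_elt l)) = g (f (basis_elt l))"
    and "\<And>m. m \<in> {1..n} \<Longrightarrow> m \<notin> {i, j, k, l} \<Longrightarrow> f (g (basis_elt m)) = g (f (basis_elt m))"
  shows "f \<in> centralizer (AutoGroup (free_group n)) g"
proof -
  have "f (g (basis_elt m)) = g (f (basis_elt m))" if "m \<in> {1..n}" for m
    using assms(3-7) that by blast
  then have "f \<otimes>\<^bsub>AutoGroup (free_group n)\<^esub> g = g \<otimes>\<^bsub>AutoGroup (free_group n)\<^esub> f"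
    using f g by (intro auto_eqI A.m_closed) (simp_all add: auto_compose basis_elt_closed)
  then show ?thesis using f by (simp add: centralizer_def)
qed

text \<open>
  Conditional equations in place of conditional expressions: products of images would otherwise
  carry a case split in every factor.
\<close>

lemma nielsen_basis_elt_cases:
  assumes "i \<in> {1..n}" "j \<in> {1..n}"
  shows "nielsen_left n i j (basis_elt i) = basis_elt j \<otimes>\<^bsub>free_group n\<^esub> basis_elt i"
    and "nielsen_right n i j (basis_elt i) = basis_elt i \<otimes>\<^bsub>free_group n\<^esub> basis_elt j"
    and "m \<in> {1..n} \<Longrightarrow> m \<noteq> i \<Longrightarrow> nielsen_left n i j (basis_elt m) = basis_elt m"
    and "m \<in> {1..n} \<Longrightarrow> m \<noteq> i \<Longrightarrow> nielsen_right n i j (basis_elt m) = basis_elt m"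
  using assms by (simp_all add: nielsen_basis_elt)

lemma partial_conjugation_basis_elt_cases:
  assumes "j \<in> {1..n}" "m \<in> {1..n}"
  shows "m \<in> S \<Longrightarrow> partial_conjugation n S j (basis_elt m)
      = basis_elt j \<otimes>\<^bsub>free_group n\<^esub> basis_elt m \<otimes>\<^bsub>free_group n\<^esub> inv\<^bsub>free_group n\<^esub> basis_elt j"
    and "m \<notin> S \<Longrightarrow> partial_conjugation n S j (basis_elt m) = basis_elt m"
  using assms by (simp_all add: partial_conjugation_basis_elt)

lemmas automorphisms = nielsen_left_auto nielsen_right_auto partial_conjugation_auto

lemmas auto_simps = automorphisms automorphisms[THEN auto_closed] automorphisms[THEN auto_mult]
  automorphisms[THEN auto_inv] auto_compose nielsen_basis_elt_cases
  partial_conjugation_basis_elt_cases basis_elt_closed F.m_assoc F.inv_mult_group F.inv_mult_cancel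

text \<open>
  With a spare index \<open>k\<close>, multiplication of \<open>a\<^sub>i\<close> by \<open>a\<^sub>j\<close> is a commutator of multiplications of \<open>a\<^sub>i\<close> by
  \<open>a\<^sub>k\<close> and of \<open>a\<^sub>k\<close> by \<open>a\<^sub>j\<close>.
\<close>

lemma nielsen_commutator:
  assumes "i \<in> {1..n}" "j \<in> {1..n}" "k \<in> {1..n}" "i \<noteq> j" "i \<noteq> k" "j \<noteq> k"
  shows "nielsen_left n k j \<otimes>\<^bsub>AutoGroup (free_group n)\<^esub> nielsen_left n i k =
      nielsen_left n i k \<otimes>\<^bsub>AutoGroup (free_group n)\<^esub> nielsen_left n k j
        \<otimes>\<^bsub>AutoGroup (free_group n)\<^esub> nielsen_left n i j" (is ?L)
    and "nielsen_right n k j \<otimes>\<^bsub>AutoGroup (free_group n)\<^esub> nielsen_right n i k =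
      nielsen_right n i k \<otimes>\<^bsub>AutoGroup (free_group n)\<^esub> nielsen_right n k j
        \<otimes>\<^bsub>AutoGroup (free_group n)\<^esub> nielsen_right n i j" (is ?R)
proof -
  (* Disequalities of indices are supplied in both orientations, so that rewriting finds them;
     the limit keeps linear arithmetic from splitting all of them in each failing side condition. *)
  note [[linarith_neq_limit = 0]]
  show ?L using assms assms(4-6)[symmetric]
    by (intro auto_eqI_cases[where i = i and j = j and k = k];
      simp add: auto_simps del: atLeastAtMost_iff)
  show ?R using assms assms(4-6)[symmetric]
    by (intro auto_eqI_cases[where i = i and j = j and k = k];
      simp add: auto_simps del: atLeastAtMost_iff)
qed

text \<open>
  Let \<open>c(w)\<close> be conjugation by \<open>w\<close> on the free factor generated by \<open>a\<^sub>i, a\<^sub>j, a\<^sub>k\<close>. Since \<open>\<lambda>\<^sub>k\<^sub>j\<close> maps \<open>a\<^sub>k\<close>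
  to \<open>a\<^sub>j a\<^sub>k\<close>, it conjugates \<open>c(a\<^sub>k)\<close> to \<open>c(a\<^sub>j) c(a\<^sub>k)\<close>, so \<open>c(a\<^sub>j)\<close> is a commutator.
\<close>

lemma partial_conjugation_commutator:
  assumes "i \<in> {1..n}" "j \<in> {1..n}" "k \<in> {1..n}" "i \<noteq> j" "i \<noteq> k" "j \<noteq> k"
  shows "nielsen_left n k j \<otimes>\<^bsub>AutoGroup (free_group n)\<^esub> partial_conjugation n {i, j} k =
      partial_conjugation n {i, k} j \<otimes>\<^bsub>AutoGroup (free_group n)\<^esub> partial_conjugation n {i, j} k
        \<otimes>\<^bsub>AutoGroup (free_group n)\<^esub> nielsen_left n k j"
  supply [[linarith_neq_limit = 0]]
  using assms assms(4-6)[symmetric]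
  by (intro auto_eqI_cases[where i = i and j = j and k = k];
    simp add: auto_simps del: atLeastAtMost_iff)

text \<open>
  Conjugation is left multiplication followed by inverse right multiplication; the right
  multiplications are moved to the other side.
\<close>

lemma partial_conjugation_eq_nielsen:
  assumes "i \<in> {1..n}" "j \<in> {1..n}" "k \<in> {1..n}" "i \<noteq> j" "i \<noteq> k" "j \<noteq> k"
  shows "nielsen_left n i j \<otimes>\<^bsub>AutoGroup (free_group n)\<^esub> nielsen_left n k j =
      partial_conjugation n {i, k} j \<otimes>\<^bsub>AutoGroup (free_group n)\<^esub>
        (nielsen_right n i j \<otimes>\<^bsub>AutoGroup (free_group n)\<^esub> nielsen_right n k j)"
  supply [[linarith_neq_limit = 0]]
  using assms assms(4-6)[symmetric]
  by (intro auto_eqI_cases[where i = i and j = j and k = k];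
    simp add: auto_simps del: atLeastAtMost_iff)

text \<open>
  The elements of the centralizer needed below move neither \<open>a\<^sub>i\<close> nor \<open>a\<^sub>j\<close>, or multiply \<open>a\<^sub>i\<close> on the
  other side, or conjugate \<open>a\<^sub>i\<close> and \<open>a\<^sub>j\<close> simultaneously.
\<close>

lemma centralizer_nielsen_left:
  assumes "i \<in> {1..n}" "j \<in> {1..n}" "k \<in> {1..n}" "l \<in> {1..n}" "distinct [i, j, k, l]"
  shows "{nielsen_left n k j, nielsen_left n k l, nielsen_left n l j,
      nielsen_right n k j, nielsen_right n k l, nielsen_right n l j, nielsen_right n i k,
      partial_conjugation n {i, j} k}
    \<subseteq> centralizer (AutoGroup (free_group n)) (nielsen_left n i j)"
proof -
  note [[linarith_neq_limit = 0]]
  have neq: "i \<noteq> j" "i \<noteq> k" "i \<noteq> l" "j \<noteq> k" "j \<noteq> l" "k \<noteq> l"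
    using assms by auto
  show ?thesis
    using assms(1-4) neq neq[symmetric] unfolding insert_subset
    by (intro conjI empty_subsetI in_centralizerI[where i = i and j = j and k = k and l = l];
      simp add: auto_simps del: atLeastAtMost_iff)
qed

lemma centralizer_nielsen_right:
  assumes "i \<in> {1..n}" "j \<in> {1..n}" "k \<in> {1..n}" "l \<in> {1..n}" "distinct [i, j, k, l]"
  shows "{nielsen_left n k j, nielsen_left n k l, nielsen_left n l j,
      nielsen_right n k l, nielsen_right n l j, nielsen_left n i k,
      partial_conjugation n {i, j} k}
    \<subseteq> centralizer (AutoGroup (free_group n)) (nielsen_right n i j)"
proof -
  note [[linarith_neq_limit = 0]]
  have neq: "i \<noteq> j" "i \<noteq> k" "i \<noteq> l" "j \<noteq> k" "j \<noteq> l" "k \<noteq> l"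
    using assms by auto
  show ?thesis
    using assms(1-4) neq neq[symmetric] unfolding insert_subset
    by (intro conjI empty_subsetI in_centralizerI[where i = i and j = j and k = k and l = l];
      simp add: auto_simps del: atLeastAtMost_iff)
qed

text \<open>
  These are commutators of elements that commute with \<open>\<nu>\<close>. It is here that a fourth index is needed:
  the factors \<open>\<lambda>\<^sub>k\<^sub>l\<close>, \<open>\<lambda>\<^sub>l\<^sub>j\<close> of \<open>\<lambda>\<^sub>k\<^sub>j\<close>, and likewise for \<open>\<rho>\<close>, must leave \<open>a\<^sub>i\<close> alone.
\<close>

lemma derived_centralizer_nielsen:
  assumes \<nu>: "\<nu> \<in> {nielsen_left n i j, nielsen_right n i j}"
    and ijkl: "i \<in> {1..n}" "j \<in> {1..n}" "k \<in> {1..n}" "l \<in> {1..n}" "distinct [i, j, k, l]"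
  defines "D \<equiv> derived (AutoGroup (free_group n)) (centralizer (AutoGroup (free_group n)) \<nu>)"
  shows "nielsen_left n k j \<in> D" "nielsen_right n k j \<in> D" "partial_conjugation n {i, k} j \<in> D"
proof -
  let ?C = "centralizer (AutoGroup (free_group n)) \<nu>"
  have C: "nielsen_left n k j \<in> ?C" "nielsen_left n k l \<in> ?C" "nielsen_left n l j \<in> ?C"
      "nielsen_right n k l \<in> ?C" "nielsen_right n l j \<in> ?C" "partial_conjugation n {i, j} k \<in> ?C"
    using \<nu> centralizer_nielsen_left[OF ijkl] centralizer_nielsen_right[OF ijkl] by auto
  have "\<nu> \<in> carrier (AutoGroup (free_group n))"
    using \<nu> ijkl nielsen_left_auto nielsen_right_auto by auto
  note in_D = A.commutator_in_derived[OF A.subgroup_centralizer[OF this], folded D_def]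
  show "nielsen_left n k j \<in> D"
    by (rule in_D(2)[OF C(2,3) _ nielsen_commutator(1)]) (use ijkl nielsen_left_auto in auto)
  show "nielsen_right n k j \<in> D"
    by (rule in_D(2)[OF C(4,5) _ nielsen_commutator(2)]) (use ijkl nielsen_right_auto in auto)
  show "partial_conjugation n {i, k} j \<in> D"
    by (rule in_D(1)[OF C(6,1) _ partial_conjugation_commutator])
      (use ijkl partial_conjugation_auto in auto)
qed

text \<open>
  In \<open>\<lambda>\<^sub>i\<^sub>j \<lambda>\<^sub>k\<^sub>j = c \<rho>\<^sub>i\<^sub>j \<rho>\<^sub>k\<^sub>j\<close>, where \<open>c\<close> conjugates \<open>a\<^sub>i\<close> and \<open>a\<^sub>k\<close> by \<open>a\<^sub>j\<close>, every factor except \<open>\<nu>\<close> lies in the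
  derived subgroup of the centralizer of \<open>\<nu>\<close>: the one of \<open>\<lambda>\<^sub>i\<^sub>j\<close>, \<open>\<rho>\<^sub>i\<^sub>j\<close> different from \<open>\<nu>\<close> because
  left and right multiplications commute.
\<close>

lemma nielsen_in_derived_centralizer:
  assumes n: "n \<ge> 4" and ij: "i \<in> {1..n}" "j \<in> {1..n}" "i \<noteq> j"
    and \<nu>: "\<nu> \<in> {nielsen_left n i j, nielsen_right n i j}"
  shows "\<nu> \<in> derived (AutoGroup (free_group n)) (centralizer (AutoGroup (free_group n)) \<nu>)"
    (is "\<nu> \<in> ?D")
proof -
  have "card ({1..n} - {i, j}) \<ge> 2"
    using n ij by (simp add: card_Diff_subset)
  then obtain k l where kl: "k \<in> {1..n} - {i, j}" "l \<in> {1..n} - {i, j}" "k \<noteq> l"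
    by (metis card_le_Suc0_iff_eq finite_Diff finite_atLeastAtMost not_less_eq_eq numeral_2_eq_2)
  then have ijkl: "i \<in> {1..n}" "j \<in> {1..n}" "k \<in> {1..n}" "l \<in> {1..n}" "distinct [i, j, k, l]"
    using ij by auto
  have \<nu>_auto: "\<nu> \<in> carrier (AutoGroup (free_group n))"
    using \<nu> ij nielsen_left_auto nielsen_right_auto by auto
  let ?C = "centralizer (AutoGroup (free_group n)) \<nu>"
  have C: "subgroup ?C (AutoGroup (free_group n))"
    using \<nu>_auto by (rule A.subgroup_centralizer)
  interpret D: subgroup ?D "AutoGroup (free_group n)"
    using subgroup.subset[OF C] by (rule A.derived_is_subgroup)
  note D = derived_centralizer_nielsen[OF \<nu> ijkl]
  let ?Q = "partial_conjugation n {i, k} j"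
  note carrier = D[THEN D.mem_carrier] nielsen_left_auto[OF ij] nielsen_right_auto[OF ij]
  have eq: "nielsen_left n i j \<otimes>\<^bsub>AutoGroup (free_group n)\<^esub> nielsen_left n k j =
      ?Q \<otimes>\<^bsub>AutoGroup (free_group n)\<^esub>
        (nielsen_right n i j \<otimes>\<^bsub>AutoGroup (free_group n)\<^esub> nielsen_right n k j)"
    using ijkl by (intro partial_conjugation_eq_nielsen) auto
  have "\<nu> = nielsen_left n i j \<or> \<nu> = nielsen_right n i j" using \<nu> by simp
  then show ?thesis
  proof
    assume left: "\<nu> = nielsen_left n i j"
    have ik: "nielsen_right n i k \<in> ?C" and kj: "nielsen_right n k j \<in> ?C"
      using centralizer_nielsen_left[OF ijkl] left by auto
    have "nielsen_right n i j \<in> ?D"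
      by (rule A.commutator_in_derived(2)[OF C ik kj _ nielsen_commutator(2)])
        (use ijkl carrier in auto)
    moreover have "nielsen_left n i j = ?Q \<otimes>\<^bsub>AutoGroup (free_group n)\<^esub>
        (nielsen_right n i j \<otimes>\<^bsub>AutoGroup (free_group n)\<^esub> nielsen_right n k j)
        \<otimes>\<^bsub>AutoGroup (free_group n)\<^esub> inv\<^bsub>AutoGroup (free_group n)\<^esub> nielsen_left n k j"
      using carrier by (simp add: A.m_assoc flip: eq)
    ultimately show ?thesis
      using D by (metis D.m_closed D.m_inv_closed left)
  next
    assume right: "\<nu> = nielsen_right n i j"
    have ik: "nielsen_left n i k \<in> ?C" and kj: "nielsen_left n k j \<in> ?C"
      using centralizer_nielsen_right[OF ijkl] right by auto
    have "nielsen_left n i j \<in> ?D"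
      by (rule A.commutator_in_derived(2)[OF C ik kj _ nielsen_commutator(1)])
        (use ijkl carrier in auto)
    moreover have "nielsen_right n i j = inv\<^bsub>AutoGroup (free_group n)\<^esub> ?Q \<otimes>\<^bsub>AutoGroup (free_group n)\<^esub>
        (nielsen_left n i j \<otimes>\<^bsub>AutoGroup (free_group n)\<^esub> nielsen_left n k j)
        \<otimes>\<^bsub>AutoGroup (free_group n)\<^esub> inv\<^bsub>AutoGroup (free_group n)\<^esub> nielsen_right n k j"
      using carrier by (simp add: eq A.m_assoc) (simp add: A.m_assoc[symmetric])
    ultimately show ?thesis
      using D by (metis D.m_closed D.m_inv_closed right)
  qed
qed

end

section \<open>Fixed points of Nielsen transformations\<close>

theorem theorem1p1:
  fixes n :: nat and X :: "'a set" and d :: "'a \<Rightarrow> 'a \<Rightarrow> real"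
    and \<phi> :: "(letter list \<Rightarrow> letter list) \<Rightarrow> 'a \<Rightarrow> 'a"
  assumes "n \<ge> 4"
    and "CAT0_space X d"
    and "Metric_space.mcomplete X d"
    and "semisimple_action (AutoGroup (free_group n)) X d \<phi>"
  shows "\<forall>\<nu>\<in>nielsen_transformations n. \<exists>x\<in>X. \<phi> \<nu> x = x"
proof
  fix \<nu> assume \<nu>: "\<nu> \<in> nielsen_transformations n"
  interpret CAT0_space X d by (rule assms(2))
  have act: "group_action (AutoGroup (free_group n)) X \<phi>"
    and ss: "semisimple (\<phi> g)" if "g \<in> carrier (AutoGroup (free_group n))" for g
    using assms(4) that by (auto simp: semisimple_action_def)
  have "\<nu> \<in> carrier (AutoGroup (free_group n))"
    using \<nu> nielsen_transformations_auto by blast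
  moreover have "\<nu> \<in> derived (AutoGroup (free_group n)) (centralizer (AutoGroup (free_group n)) \<nu>)"
    using \<nu> nielsen_in_derived_centralizer[OF assms(1)]
    by (auto simp: nielsen_transformations_def)
  ultimately show "\<exists>x\<in>X. \<phi> \<nu> x = x"
    using semisimple_in_derived_centralizer_fixes_point[OF assms(2) act] ss
    by (auto simp: semisimple_def)
qed

end
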